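(* Let $n\ge 2$ and let $G_n$ be the union of two copies $K$ and $K'$ of $K_n$ joined by a single edge: $V(K)=\{w_1,\dots,w_n\}$, $V(K')=\{v_1,\dots,v_n\}$, and the joining edge is $w_1v_n$. Consider the ranking $f$ of $G_n$ given by $f(w_i)=i$ for $1\le i\le n$, $f(v_i)=i$ for $1\le i\le n-1$, and $f(v_n)=n+1$. Then: (1) any edge not in $G_n$ connecting a vertex with highest label (under $f$) in one copy with any other vertex in the other copy is good for $G_n$, and all other edges not in $G_n$ are forbidden; moreover, if $H$ is the set of all good edges for $G_n$, then $\chi_r(G_n\cup H)=\chi_r(G_n)=n+1$; (2) $\mu(G_n)=2(n-1)$.
   Context: A $k$-ranking of a graph $G$ is a labeling $f:V(G)\to\{1,\dots,k\}$ such that whenever $f(u)=f(v)$ for distinct $u,v$, every $u$–$v$ path contains a vertex $w$ with $f(w)>f(u)$; the rank number $\chi_r(G)$ is the smallest $k$ for which $G$ has a $k$-ranking. An edge $e$ on $V(G)$ not in $G$ is good for $G$ if $\chi_r(G\cup\{e\})=\chi_r(G)$ and forbidden if $\chi_r(G\cup\{e\})>\chi_r(G)$. $\mu(G)$ denotes the maximum cardinality of a set $H$ of edges on $V(G)$, not in $G$, such that $\chi_r(G\cup H)=\chi_r(G)$.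
   Formalization: "All other edges are forbidden" and "H is the set of all good edges" are read relative to the fixed ranking f (f stops/stays a ranking after adding the edge), since every non-edge is good in the absolute sense; other edges are also shown forbidden for G_n ∪ H. *)

theory Defs
  imports Main
begin

type_synonym 'a ugraph = "'a set \<times> 'a set set"

abbreviation verts :: "'a ugraph \<Rightarrow> 'a set" where "verts G \<equiv> fst G"
abbreviation edges :: "'a ugraph \<Rightarrow> 'a set set" where "edges G \<equiv> snd G"

definition pairs :: "'a set \<Rightarrow> 'a set set" where
  "pairs S = {e. e \<subseteq> S \<and> card e = 2}"

definition non_edges :: "'a ugraph \<Rightarrow> 'a set set" where
  "non_edges G = pairs (verts G) - edges G"

definition add_edges :: "'a ugraph \<Rightarrow> 'a set set \<Rightarrow> 'a ugraph" where
  "add_edges G H = (verts G, edges G \<union> H)"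

definition is_path :: "'a ugraph \<Rightarrow> 'a \<Rightarrow> 'a list \<Rightarrow> 'a \<Rightarrow> bool" where
  "is_path G u p v \<longleftrightarrow>
     p \<noteq> [] \<and> hd p = u \<and> last p = v \<and> distinct p \<and> set p \<subseteq> verts G \<and>
     successively (\<lambda>x y. {x, y} \<in> edges G) p"

definition is_ranking :: "'a ugraph \<Rightarrow> nat \<Rightarrow> ('a \<Rightarrow> nat) \<Rightarrow> bool" where
  "is_ranking G k f \<longleftrightarrow>
     f ` verts G \<subseteq> {1..k} \<and>
     (\<forall>u \<in> verts G. \<forall>v \<in> verts G. u \<noteq> v \<longrightarrow> f u = f v \<longrightarrow>
        (\<forall>p. is_path G u p v \<longrightarrow> (\<exists>w \<in> set p. f w > f u)))"

definition rank_number :: "'a ugraph \<Rightarrow> nat" where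
  "rank_number G = (LEAST k. \<exists>f. is_ranking G k f)"

definition good_edge :: "'a ugraph \<Rightarrow> 'a set \<Rightarrow> bool" where
  "good_edge G e \<longleftrightarrow>
     e \<in> non_edges G \<and> rank_number (add_edges G {e}) = rank_number G"

definition forbidden_edge :: "'a ugraph \<Rightarrow> 'a set \<Rightarrow> bool" where
  "forbidden_edge G e \<longleftrightarrow>
     e \<in> non_edges G \<and> rank_number (add_edges G {e}) > rank_number G"

text \<open>
  Good and forbidden relative to a fixed optimal ranking: the edge does, respectively
  does not, leave that very labelling a ranking with \<open>rank_number G\<close> labels.
  This differs from the absolute notions above, where the labels may be reassigned after
  the edge is added: good under some \<open>f\<close> implies \<open>good_edge\<close>, but an edge
  that is forbidden under a given \<open>f\<close> may still be a \<open>good_edge\<close>.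
\<close>

definition good_edge_under :: "('a \<Rightarrow> nat) \<Rightarrow> 'a ugraph \<Rightarrow> 'a set \<Rightarrow> bool" where
  "good_edge_under f G e \<longleftrightarrow>
     e \<in> non_edges G \<and> is_ranking (add_edges G {e}) (rank_number G) f"

definition forbidden_edge_under :: "('a \<Rightarrow> nat) \<Rightarrow> 'a ugraph \<Rightarrow> 'a set \<Rightarrow> bool" where
  "forbidden_edge_under f G e \<longleftrightarrow>
     e \<in> non_edges G \<and> \<not> is_ranking (add_edges G {e}) (rank_number G) f"

definition mu :: "'a ugraph \<Rightarrow> nat" where
  "mu G = Max (card ` {H. H \<subseteq> non_edges G \<and>
     rank_number (add_edges G H) = rank_number G})"

text \<open>\<open>W i\<close> and \<open>V i\<close> are the vertices $w_i$ and $v_i$ of the two copies.\<close>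

datatype vertex = W nat | V nat

definition left_copy :: "nat \<Rightarrow> vertex set" where "left_copy n = W ` {1..n}"
definition right_copy :: "nat \<Rightarrow> vertex set" where "right_copy n = V ` {1..n}"

definition joined_cliques :: "nat \<Rightarrow> vertex ugraph" where
  "joined_cliques n =
     (left_copy n \<union> right_copy n,
      pairs (left_copy n) \<union> pairs (right_copy n) \<union> {{W 1, V n}})"

fun std_ranking :: "nat \<Rightarrow> vertex \<Rightarrow> nat" where
  "std_ranking n (W i) = i"
| "std_ranking n (V i) = (if i = n then n + 1 else i)"

definition top_edges :: "nat \<Rightarrow> vertex set set" where
  "top_edges n =
     {e \<in> non_edges (joined_cliques n). \<exists>x y. e = {x, y} \<and>
        (is_arg_max (std_ranking n) (\<lambda>z. z \<in> left_copy n) x \<and> y \<in> right_copy n \<or>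
         is_arg_max (std_ranking n) (\<lambda>z. z \<in> right_copy n) x \<and> y \<in> left_copy n)}"

end

theory Submission
  imports Defs
begin

text \<open>
  Any ranking is injective on each clique. If two vertices, one in each clique, both carry labels
  that occur in both cliques, they cannot be adjacent: such an edge would give a path of at most
  three vertices whose ends share the label and whose interior has a smaller one. Hence, when the
  cliques share \<open>c\<close> labels, at most \<open>n\<^sup>2 - c\<^sup>2\<close> edges run between them. With \<open>k\<close> labels
  \<open>c \<ge> 2n - k\<close>. As there is an edge between the cliques, \<open>c < n\<close>, so \<open>k > n\<close>; and \<open>k = n + 1\<close>
  forces \<open>c = n - 1\<close> and leaves room for \<open>2n - 1\<close> edges, one of which is in the graph already.
\<close>

section \<open>Paths and rankings in arbitrary graphs\<close>

lemma doubleton_in_pairs_iff: "{x, y} \<in> pairs S \<longleftrightarrow> x \<in> S \<and> y \<in> S \<and> x \<noteq> y"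
  by (auto simp: pairs_def card_insert_if)

lemma pairsE:
  assumes "e \<in> pairs S"
  obtains x y where "e = {x, y}" "x \<in> S" "y \<in> S" "x \<noteq> y"
  using assms by (auto simp: pairs_def card_2_iff)

lemma verts_add_edges [simp]: "verts (add_edges G H) = verts G"
  and edges_add_edges [simp]: "edges (add_edges G H) = edges G \<union> H"
  by (simp_all add: add_edges_def)

text \<open>Removing edges removes paths, so there is less to separate. This passes a ranking from
  all top edges down to any subset of them.\<close>

lemma is_ranking_subgraph:
  assumes "is_ranking G k f" "verts G' = verts G" "edges G' \<subseteq> edges G"
  shows "is_ranking G' k f"
proof -
  have "is_path G u p v" if "is_path G' u p v" for u p v
    using that assms(2,3) unfolding is_path_def
    by (auto elim: successively_mono)
  then show ?thesis using assms(1,2) unfolding is_ranking_def by auto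
qed

lemma is_ranking_edge:
  assumes "is_ranking G k f" "u \<in> verts G" "v \<in> verts G" "u \<noteq> v" "{u, v} \<in> edges G"
  shows "f u \<noteq> f v"
proof
  assume eq: "f u = f v"
  have "is_path G u [u, v] v" using assms by (simp add: is_path_def)
  then have "\<exists>w \<in> set [u, v]. f w > f u"
    using assms eq unfolding is_ranking_def by blast
  then show False using eq by auto
qed

text \<open>The ends share the label, so only the middle vertex can exceed it. Paths with one or two
  edges are the only ones on which the lower bounds rest.\<close>

lemma is_ranking_two_edges:
  assumes "is_ranking G k f" "{u, w, v} \<subseteq> verts G" "distinct [u, w, v]"
    "{u, w} \<in> edges G" "{w, v} \<in> edges G" "f u = f v"
  shows "f u < f w"
proof -
  have "is_path G u [u, w, v] v" using assms by (simp add: is_path_def)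
  then have "\<exists>x \<in> set [u, w, v]. f x > f u"
    using assms unfolding is_ranking_def by (metis distinct_length_2_or_more insert_subset)
  then show ?thesis using assms(6) by auto
qed

text \<open>Under an injective labelling the path condition is vacuous. Hence the
  \<open>LEAST\<close> in \<open>rank_number\<close> is attained.\<close>

lemma ex_ranking:
  assumes "finite (verts G)"
  shows "\<exists>k f. is_ranking G k f"
proof -
  obtain f where "bij_betw f (verts G) {1..card (verts G)}"
    using assms ex_bij_betw_finite_nat[of "verts G"]
    by (metis card_atLeastAtMost diff_Suc_1 finite_atLeastAtMost finite_same_card_bij)
  then have "is_ranking G (card (verts G)) f"
    unfolding is_ranking_def bij_betw_def by (auto dest: inj_onD)
  then show ?thesis by blast
qed

lemma rank_number_is_ranking:
  assumes "finite (verts G)"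
  shows "\<exists>f. is_ranking G (rank_number G) f"
  unfolding rank_number_def using ex_ranking[OF assms] by (rule LeastI_ex)

lemma rank_number_le: "is_ranking G k f \<Longrightarrow> rank_number G \<le> k"
  unfolding rank_number_def by (auto intro: Least_le)

text \<open>Applied with \<open>h\<close> telling in which clique a vertex lies: a path that never
  switches cliques ends where it started.\<close>

lemma successively_constant:
  assumes "successively (\<lambda>x y. h x = h y) p" "x \<in> set p"
  shows "h x = h (hd p)"
  using assms by (induction p rule: induct_list012) auto

section \<open>Joined cliques, with the edges between them coded by index pairs\<close>

definition cross :: "nat \<times> nat \<Rightarrow> vertex set" where
  "cross p = {W (fst p), V (snd p)}"

text \<open>Lets sets of edges between the cliques be counted inside the grid
  \<open>{1..n} \<times> {1..n}\<close>.\<close>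

lemma inj_cross: "inj cross"
  by (auto simp: inj_def cross_def doubleton_eq_iff)

lemma verts_joined_cliques: "verts (joined_cliques n) = W ` {1..n} \<union> V ` {1..n}"
  by (simp add: joined_cliques_def left_copy_def right_copy_def)

lemma edges_joined_cliques_iff [simp]:
  "{W a, W b} \<in> edges (joined_cliques n) \<longleftrightarrow> a \<in> {1..n} \<and> b \<in> {1..n} \<and> a \<noteq> b"
  "{V a, V b} \<in> edges (joined_cliques n) \<longleftrightarrow> a \<in> {1..n} \<and> b \<in> {1..n} \<and> a \<noteq> b"
  "{W a, V b} \<in> edges (joined_cliques n) \<longleftrightarrow> a = 1 \<and> b = n"
  "{V b, W a} \<in> edges (joined_cliques n) \<longleftrightarrow> a = 1 \<and> b = n"
  by (auto simp: joined_cliques_def left_copy_def right_copy_def doubleton_in_pairs_iff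
      doubleton_eq_iff)

lemma non_edges_joined_cliques:
  "non_edges (joined_cliques n) = cross ` ({1..n} \<times> {1..n} - {(1, n)})"
proof (intro equalityI subsetI)
  fix e assume e: "e \<in> non_edges (joined_cliques n)"
  then have "e \<in> pairs (verts (joined_cliques n))" by (simp add: non_edges_def)
  then obtain x y where xy: "e = {x, y}" "x \<in> verts (joined_cliques n)"
    "y \<in> verts (joined_cliques n)" "x \<noteq> y" by (rule pairsE)
  have ne: "{x, y} \<notin> edges (joined_cliques n)" using e xy by (simp add: non_edges_def)
  obtain a b where "e = {W a, V b}" "a \<in> {1..n}" "b \<in> {1..n}"
    using xy ne unfolding verts_joined_cliques
    by (elim UnE imageE) (auto simp: insert_commute)
  moreover from this have "(a, b) \<noteq> (1, n)" using ne xy(1) by auto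
  ultimately show "e \<in> cross ` ({1..n} \<times> {1..n} - {(1, n)})"
    by (intro image_eqI[where x = "(a, b)"]) (auto simp: cross_def)
next
  fix e assume "e \<in> cross ` ({1..n} \<times> {1..n} - {(1, n)})"
  then show "e \<in> non_edges (joined_cliques n)"
    by (auto simp: non_edges_def cross_def verts_joined_cliques doubleton_in_pairs_iff)
qed

lemma is_arg_max_left:
  assumes "n \<ge> 1"
  shows "is_arg_max (std_ranking n) (\<lambda>z. z \<in> left_copy n) x \<longleftrightarrow> x = W n"
proof
  assume max: "is_arg_max (std_ranking n) (\<lambda>z. z \<in> left_copy n) x"
  have "W n \<in> left_copy n" using assms by (simp add: left_copy_def)
  with max have "\<not> std_ranking n x < std_ranking n (W n)" "x \<in> left_copy n"
    unfolding is_arg_max_def by blast+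
  then show "x = W n" by (auto simp: left_copy_def)
qed (use assms in \<open>auto simp: is_arg_max_def left_copy_def\<close>)

lemma is_arg_max_right:
  assumes "n \<ge> 1"
  shows "is_arg_max (std_ranking n) (\<lambda>z. z \<in> right_copy n) x \<longleftrightarrow> x = V n"
proof
  assume max: "is_arg_max (std_ranking n) (\<lambda>z. z \<in> right_copy n) x"
  have "V n \<in> right_copy n" using assms by (simp add: right_copy_def)
  with max have "\<not> std_ranking n x < std_ranking n (V n)" "x \<in> right_copy n"
    unfolding is_arg_max_def by blast+
  then show "x = V n" by (auto simp: right_copy_def split: if_splits)
qed (use assms in \<open>auto simp: is_arg_max_def right_copy_def\<close>)

text \<open>The grid without a square of side \<open>n - 1\<close> and without the joining edge: the
  same shape as the extremal case of the upper bound on \<open>card H\<close>, where the square is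
  \<open>A \<times> B\<close>.\<close>

lemma top_edges_eq:
  assumes "n \<ge> 1"
  shows "top_edges n = cross ` ({1..n} \<times> {1..n} - {1..<n} \<times> {1..<n} - {(1, n)})"
proof -
  let ?top = "\<lambda>e. \<exists>x y. e = {x, y} \<and>
    (x = W n \<and> y \<in> right_copy n \<or> x = V n \<and> y \<in> left_copy n)"
  have top: "?top (cross p) \<longleftrightarrow> fst p = n \<or> snd p = n" if "p \<in> {1..n} \<times> {1..n}" for p
  proof -
    have "W (fst p) \<in> left_copy n" "V (snd p) \<in> right_copy n"
      using that by (auto simp: left_copy_def right_copy_def)
    moreover have "W n \<notin> right_copy n" "V n \<notin> left_copy n"
      by (auto simp: left_copy_def right_copy_def)
    ultimately show ?thesis
      unfolding cross_def
      by (metis doubleton_eq_iff insert_commute vertex.inject vertex.distinct(1))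
  qed
  have "top_edges n = cross ` {p \<in> {1..n} \<times> {1..n} - {(1, n)}. ?top (cross p)}"
    unfolding top_edges_def is_arg_max_left[OF assms] is_arg_max_right[OF assms]
      non_edges_joined_cliques Compr_image_eq ..
  also have "{p \<in> {1..n} \<times> {1..n} - {(1, n)}. ?top (cross p)} =
      {p \<in> {1..n} \<times> {1..n} - {(1, n)}. fst p = n \<or> snd p = n}"
    by (intro Collect_cong conj_cong refl top) simp
  also have "\<dots> = {1..n} \<times> {1..n} - {1..<n} \<times> {1..<n} - {(1, n)}"
    by auto
  finally show ?thesis .
qed

lemma top_edges_subset_non_edges: "top_edges n \<subseteq> non_edges (joined_cliques n)"
  by (auto simp: top_edges_def)

lemma card_top_edges:
  assumes "n \<ge> 2"
  shows "card (top_edges n) = 2 * (n - 1)"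
proof -
  let ?S = "{1..n} \<times> {1..n} - {1..<n} \<times> {1..<n}"
  have "card (top_edges n) = card (?S - {(1, n)})"
    using assms by (simp add: top_edges_eq card_image inj_on_subset[OF inj_cross])
  also have "\<dots> = card ?S - 1" using assms by (subst card_Diff_singleton) auto
  also have "card ?S = n * n - (n - 1) * (n - 1)"
    by (subst card_Diff_subset) (auto simp: card_cartesian_product)
  also have "n * n - (n - 1) * (n - 1) - 1 = 2 * (n - 1)"
    using assms by (cases n) auto
  finally show ?thesis .
qed

section \<open>Rankings of the joined cliques with added edges\<close>

lemma is_ranking_top_edges:
  assumes "n \<ge> 2"
  shows "is_ranking (add_edges (joined_cliques n) (top_edges n)) (n + 1) (std_ranking n)"
proof -
  let ?G = "add_edges (joined_cliques n) (top_edges n)"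
  let ?f = "std_ranking n"
  let ?left = "\<lambda>x. case x of W _ \<Rightarrow> True | V _ \<Rightarrow> False"
  \<comment> \<open>The joining edge is covered too, through its end \<open>V n\<close>. So every
    edge between the cliques has an end with label at least \<open>n\<close>.\<close>
  have cross_edge: "a = n \<or> b = n"
    if "{W a, V b} \<in> edges ?G \<or> {V b, W a} \<in> edges ?G" for a b
    using that assms by (auto simp: top_edges_eq cross_def doubleton_eq_iff insert_commute)
  have high: "\<exists>w \<in> set p. ?f w > ?f u"
    if uv: "u \<in> verts ?G" "v \<in> verts ?G" "u \<noteq> v" "?f u = ?f v" and p: "is_path ?G u p v"
    for u v p
  proof (rule ccontr)
    assume low: "\<not> (\<exists>w \<in> set p. ?f w > ?f u)"
    \<comment> \<open>Labels are distinct within a clique, and neither \<open>n\<close> nor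
      \<open>n + 1\<close> occurs in both cliques.\<close>
    have sides: "?left u \<noteq> ?left v" and "?f u < n"
      using uv by (auto simp: verts_joined_cliques split: if_splits)
    then have less: "?f x < n" if "x \<in> set p" for x
      using low that by (meson le_less_trans not_le)
    \<comment> \<open>With all labels on \<open>p\<close> below \<open>n\<close>, no edge between
      the cliques is available to \<open>p\<close>, although its ends lie on different
      sides.\<close>
    have "?left x = ?left y" if "x \<in> set p" "y \<in> set p" "{x, y} \<in> edges ?G" for x y
      using less[OF that(1)] less[OF that(2)] cross_edge that(3)
      by (cases x; cases y) (force split: if_splits)+
    then have "successively (\<lambda>x y. ?left x = ?left y) p"
      using p unfolding is_path_def by (auto elim: successively_mono)
    then have "?left v = ?left u"
      using p unfolding is_path_def by (metis last_in_set successively_constant)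
    with sides show False by simp
  qed
  moreover have "?f ` verts ?G \<subseteq> {1..n + 1}"
    by (auto simp: verts_joined_cliques)
  ultimately show ?thesis unfolding is_ranking_def by blast
qed

text \<open>The assumption \<open>k \<le> n + 1\<close> serves both conclusions: it turns the count
  of shared labels into the exact value \<open>n - 1\<close>, which fixes \<open>k\<close> and the
  number of excluded index pairs.\<close>

lemma ranking_joined_cliques_bounds:
  assumes n: "n \<ge> 2" and H: "H \<subseteq> non_edges (joined_cliques n)"
    and r: "is_ranking (add_edges (joined_cliques n) H) k g" and k: "k \<le> n + 1"
  shows "k = n + 1" and "card H \<le> 2 * (n - 1)"
proof -
  let ?G = "add_edges (joined_cliques n) H"
  let ?L = "{1..n}"
  have verts: "W a \<in> verts ?G" "V a \<in> verts ?G" if "a \<in> ?L" for a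
    using that by (auto simp: verts_joined_cliques)
  have cliques: "{W a, W b} \<in> edges ?G" "{V a, V b} \<in> edges ?G"
    if "a \<in> ?L" "b \<in> ?L" "a \<noteq> b" for a b
    using that by auto
  define P where "P = g ` W ` ?L"
  define Q where "Q = g ` V ` ?L"
  \<comment> \<open>\<open>A\<close> and \<open>B\<close> index the vertices whose label occurs in
    both cliques; each set has as many elements as there are shared labels.\<close>
  define A where "A = {a \<in> ?L. g (W a) \<in> Q}"
  define B where "B = {b \<in> ?L. g (V b) \<in> P}"
  have injW: "inj_on (\<lambda>a. g (W a)) ?L" and injV: "inj_on (\<lambda>a. g (V a)) ?L"
    using is_ranking_edge[OF r] verts cliques by (meson inj_onI vertex.inject)+
  have cardPQ: "card P = n" "card Q = n"
    unfolding P_def Q_def image_image using card_image[OF injW] card_image[OF injV] by simp_all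
  have PQ: "P \<union> Q \<subseteq> {1..k}"
    using r verts unfolding is_ranking_def P_def Q_def by blast
  have fin: "finite P" "finite Q" by (simp_all add: P_def Q_def)
  have "card A = card (P \<inter> Q)"
    by (rule bij_betw_same_card[of "\<lambda>a. g (W a)"], rule bij_betw_imageI)
      (auto simp: A_def P_def intro: inj_on_subset[OF injW])
  moreover have "card B = card (P \<inter> Q)"
    by (rule bij_betw_same_card[of "\<lambda>a. g (V a)"], rule bij_betw_imageI)
      (auto simp: B_def Q_def intro: inj_on_subset[OF injV])
  moreover have "card (P \<union> Q) + card (P \<inter> Q) = 2 * n"
    using card_Un_Int[OF fin] cardPQ by simp
  moreover have "card (P \<union> Q) \<le> k" using card_mono[OF _ PQ] by simp
  ultimately have cardA: "2 * n \<le> k + card A" and cardAB: "card B = card A" by simp_all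
  have sub: "A \<subseteq> ?L" "B \<subseteq> ?L" by (auto simp: A_def B_def)
  have no_cross: "{W a, V b} \<notin> edges ?G" if ab: "a \<in> A" "b \<in> B" for a b
  proof
    assume e: "{W a, V b} \<in> edges ?G"
    \<comment> \<open>\<open>V b'\<close> and \<open>W a'\<close> are the partners carrying the
      labels of \<open>W a\<close> and \<open>V b\<close>. The path \<open>W a'\<close>,
      \<open>W a\<close>, \<open>V b\<close> forces \<open>W a\<close> above \<open>V b\<close>, and
      the path \<open>V b'\<close>, \<open>V b\<close>, \<open>W a\<close> forces the
      opposite.\<close>
    obtain b' where b': "b' \<in> ?L" "g (V b') = g (W a)"
      using ab by (auto simp: A_def Q_def)
    obtain a' where a': "a' \<in> ?L" "g (W a') = g (V b)"
      using ab by (auto simp: B_def P_def)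
    have L: "a \<in> ?L" "b \<in> ?L" using ab sub by auto
    have neq: "g (W a) \<noteq> g (V b)"
      using is_ranking_edge[OF r verts(1)[OF L(1)] verts(2)[OF L(2)] _ e] by simp
    then have "a' \<noteq> a" "b' \<noteq> b" using a' b' by auto
    then have "g (W a') < g (W a)"
      using is_ranking_two_edges[OF r, of "W a'" "W a" "V b"] a' L e verts cliques by auto
    moreover have "g (V b') < g (V b)"
      using is_ranking_two_edges[OF r, of "V b'" "V b" "W a"] b' \<open>b' \<noteq> b\<close> L e verts cliques
      by (auto simp: insert_commute)
    ultimately show False using a' b' by simp
  qed
  have one_n: "{W 1, V n} \<in> edges ?G" by simp
  \<comment> \<open>The joining edge itself has index pair \<open>(1, n)\<close>, which therefore
    cannot lie in \<open>A \<times> B\<close>.\<close>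
  have not_both: "\<not> (A = ?L \<and> B = ?L)" using no_cross[of 1 n] n by auto
  have "card A \<noteq> n"
  proof
    assume "card A = n"
    then have "A = ?L" "B = ?L"
      using sub cardAB by (simp_all add: card_subset_eq)
    with not_both show False by blast
  qed
  then have cA: "card A < n" using card_mono[OF _ sub(1)] by simp
  then show k': "k = n + 1" using cardA k by linarith
  then have A: "card A = n - 1" using cA cardA by linarith
  obtain Y where Y: "H = cross ` Y" "Y \<subseteq> ?L \<times> ?L - {(1, n)}"
    using H unfolding non_edges_joined_cliques subset_image_iff by blast
  have finY: "finite Y" using Y(2) by (rule finite_subset) auto
  \<comment> \<open>The joining edge is counted along with \<open>H\<close>; it accounts for the one
    subtracted from \<open>n * n - (n - 1) * (n - 1)\<close>.\<close>
  have "cross p \<in> edges ?G" if "p \<in> insert (1, n) Y" for p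
    using that one_n Y(1) by (auto simp: cross_def)
  then have "p \<notin> A \<times> B" if "p \<in> insert (1, n) Y" for p
    using that no_cross[of "fst p" "snd p"] by (auto simp: cross_def mem_Times_iff)
  moreover have "insert (1, n) Y \<subseteq> ?L \<times> ?L" using Y(2) n by auto
  ultimately have "insert (1, n) Y \<subseteq> ?L \<times> ?L - A \<times> B" by blast
  then have "card (insert (1, n) Y) \<le> card (?L \<times> ?L - A \<times> B)"
    by (intro card_mono) auto
  also have "\<dots> = n * n - (n - 1) * (n - 1)"
    using sub A cardAB finite_subset[OF sub(1)] finite_subset[OF sub(2)]
    by (subst card_Diff_subset) (auto simp: card_cartesian_product)
  also have "\<dots> = 2 * (n - 1) + 1" using n by (cases n) auto
  finally have "card Y + 1 \<le> 2 * (n - 1) + 1"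
    using Y(2) finY by (subst (asm) card_insert_disjoint) auto
  then show "card H \<le> 2 * (n - 1)"
    using Y(1) by (simp add: card_image inj_on_subset[OF inj_cross])
qed

section \<open>Rank numbers and the size of added edge sets\<close>

lemma finite_verts_joined_cliques: "finite (verts (joined_cliques n))"
  by (simp add: verts_joined_cliques)

lemma finite_non_edges_joined_cliques: "finite (non_edges (joined_cliques n))"
  by (simp add: non_edges_joined_cliques)

text \<open>A ranking attaining a smaller rank number would meet the assumption
  \<open>k \<le> n + 1\<close> of the bounds, which then force \<open>k = n + 1\<close>.\<close>

lemma rank_number_joined_cliques_ge:
  assumes "n \<ge> 2" "H \<subseteq> non_edges (joined_cliques n)"
  shows "n + 1 \<le> rank_number (add_edges (joined_cliques n) H)"
proof (rule ccontr)
  assume less: "\<not> ?thesis"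
  obtain g where "is_ranking (add_edges (joined_cliques n) H)
      (rank_number (add_edges (joined_cliques n) H)) g"
    using rank_number_is_ranking[of "add_edges (joined_cliques n) H"]
      finite_verts_joined_cliques by auto
  from ranking_joined_cliques_bounds(1)[OF assms this] less show False by simp
qed

lemma card_le_if_rank_number_joined_cliques:
  assumes "n \<ge> 2" "H \<subseteq> non_edges (joined_cliques n)"
    and "rank_number (add_edges (joined_cliques n) H) = n + 1"
  shows "card H \<le> 2 * (n - 1)"
proof -
  obtain g where "is_ranking (add_edges (joined_cliques n) H) (n + 1) g"
    using rank_number_is_ranking[of "add_edges (joined_cliques n) H"]
      finite_verts_joined_cliques assms(3) by auto
  from ranking_joined_cliques_bounds(2)[OF assms(1,2) this] show ?thesis by simp
qed

lemma rank_number_subset_top_edges: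
  assumes "n \<ge> 2" "H \<subseteq> top_edges n"
  shows "is_ranking (add_edges (joined_cliques n) H) (n + 1) (std_ranking n)"
    and "rank_number (add_edges (joined_cliques n) H) = n + 1"
proof -
  show r: "is_ranking (add_edges (joined_cliques n) H) (n + 1) (std_ranking n)"
    by (rule is_ranking_subgraph[OF is_ranking_top_edges[OF assms(1)]]) (use assms in auto)
  show "rank_number (add_edges (joined_cliques n) H) = n + 1"
    using rank_number_le[OF r] rank_number_joined_cliques_ge[OF assms(1)]
      assms(2) top_edges_subset_non_edges by (meson le_antisym subset_trans)
qed

text \<open>Both ends of such an edge have an index below \<open>n\<close>, which is also their
  label. Equal indices make equal labels adjacent; otherwise the end with the larger index, the
  other end and the copy of the former in the opposite clique form a path with too small a middle
  label. The value of \<open>k\<close> does not enter.\<close>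

lemma not_is_ranking_non_top_edge:
  assumes "n \<ge> 1" "e \<in> non_edges (joined_cliques n) - top_edges n"
  shows "\<not> is_ranking (add_edges (joined_cliques n) {e}) k (std_ranking n)"
proof
  let ?G = "add_edges (joined_cliques n) {e}"
  assume r: "is_ranking ?G k (std_ranking n)"
  obtain p where p: "e = cross p" "p \<in> {1..n} \<times> {1..n} - {(1, n)}"
    using assms(2) unfolding non_edges_joined_cliques by blast
  then have "p \<in> {1..<n} \<times> {1..<n}"
    using assms(2) unfolding top_edges_eq[OF assms(1)] by blast
  then obtain a b where ab: "e = {W a, V b}" "a \<in> {1..<n}" "b \<in> {1..<n}"
    using p(1) by (auto simp: cross_def)
  consider "a = b" | "a < b" | "b < a" by linarith
  then show False
  proof cases
    case 1
    then show False
      using is_ranking_edge[OF r, of "W a" "V b"] ab by (auto simp: verts_joined_cliques)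
  next
    case 2
    then show False
      using is_ranking_two_edges[OF r, of "W b" "W a" "V b"] ab
      by (auto simp: verts_joined_cliques)
  next
    case 3
    then show False
      using is_ranking_two_edges[OF r, of "V a" "V b" "W a"] ab
      by (auto simp: verts_joined_cliques insert_commute)
  qed
qed

text \<open>A single non-top edge need not raise the rank number once relabelling is allowed: for
  \<open>n = 2\<close>, adding \<open>{W 1, V 1}\<close> gives a triangle with a pendant vertex,
  still of rank number 3. Hence "forbidden" is asserted for the labelling \<open>f\<close>, and in
  the absolute sense only after all edges of \<open>H\<close> are present.\<close>

theorem theorem4p4:
  fixes n :: nat and G :: "vertex ugraph" and f :: "vertex \<Rightarrow> nat" and H :: "vertex set set"
  assumes "n \<ge> 2"
    and "G = joined_cliques n"
    and "f = std_ranking n"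
    and "H = {e. good_edge_under f G e}"
  shows "is_ranking G (n + 1) f
    \<and> (\<forall>e \<in> top_edges n. good_edge G e \<and> good_edge_under f G e)
    \<and> (\<forall>e \<in> non_edges G - top_edges n.
          forbidden_edge_under f G e \<and> forbidden_edge (add_edges G H) e)
    \<and> rank_number (add_edges G H) = rank_number G
    \<and> rank_number G = n + 1
    \<and> mu G = 2 * (n - 1)"
proof -
  note n = assms(1)
  note top = rank_number_subset_top_edges[OF n, folded assms(2,3)]
  note non = top_edges_subset_non_edges[of n, folded assms(2)]
  have G0: "add_edges G {} = G" by (simp add: add_edges_def)
  have rG: "is_ranking G (n + 1) f" and rank: "rank_number G = n + 1"
    using top[of "{}"] by (simp_all add: G0)
  have good: "good_edge G e \<and> good_edge_under f G e" if "e \<in> top_edges n" for e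
    using that top[of "{e}"] non rank by (auto simp: good_edge_def good_edge_under_def)
  have forb: "forbidden_edge_under f G e" if "e \<in> non_edges G - top_edges n" for e
    using that not_is_ranking_non_top_edge[of n e] n assms(2,3)
    by (auto simp: forbidden_edge_under_def)
  \<comment> \<open>Top edges are good under \<open>f\<close> and all other non-edges are not, so
    the two cases determine \<open>H\<close> exactly.\<close>
  have H: "H = top_edges n"
    using good forb assms(4) by (auto simp: good_edge_under_def forbidden_edge_under_def)
  have rankH: "rank_number (add_edges G H) = n + 1" using top H by simp
  have forbH: "forbidden_edge (add_edges G H) e" if e: "e \<in> non_edges G - top_edges n" for e
  proof -
    let ?H = "insert e (top_edges n)"
    have sub: "?H \<subseteq> non_edges G" using e non by auto
    have add: "add_edges (add_edges G H) {e} = add_edges G ?H"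
      by (auto simp: add_edges_def H)
    have "finite (top_edges n)"
      using non finite_non_edges_joined_cliques assms(2) by (metis finite_subset)
    \<comment> \<open>One edge beyond the top edges already exceeds the size allowed at rank number
      \<open>n + 1\<close>.\<close>
    then have "card ?H > 2 * (n - 1)" using e n by (simp add: card_top_edges)
    then have "rank_number (add_edges G ?H) \<noteq> n + 1"
      using card_le_if_rank_number_joined_cliques[OF n] sub assms(2) by (meson not_le)
    moreover have "n + 1 \<le> rank_number (add_edges G ?H)"
      using rank_number_joined_cliques_ge[OF n] sub assms(2) by blast
    moreover have "e \<in> non_edges (add_edges G H)" using e by (auto simp: non_edges_def H)
    ultimately show ?thesis by (simp add: forbidden_edge_def add rankH)
  qed
  have "mu G = 2 * (n - 1)"
    unfolding mu_def rank
  proof (rule Max_eqI)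
    show "finite (card ` {H. H \<subseteq> non_edges G \<and> rank_number (add_edges G H) = n + 1})"
      using finite_non_edges_joined_cliques[of n] assms(2) by simp
    show "y \<le> 2 * (n - 1)"
      if "y \<in> card ` {H. H \<subseteq> non_edges G \<and> rank_number (add_edges G H) = n + 1}" for y
      using that card_le_if_rank_number_joined_cliques[OF n] assms(2) by auto
    \<comment> \<open>The maximum is attained by \<open>top_edges n\<close>.\<close>
    show "2 * (n - 1) \<in> card ` {H. H \<subseteq> non_edges G \<and> rank_number (add_edges G H) = n + 1}"
      using top(2)[OF subset_refl] non card_top_edges[OF n, symmetric] by blast
  qed
  then show ?thesis using rG good forb forbH rankH rank by simp
qed

end
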